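(* All singular trajectories of the time-optimal problem on the Cartan group described in the context are optimal.
   Context: Let $M=\mathbb R^5$ with coordinates $(x,y,z,v,w)$, and let $X_1=\partial_x-\frac y2\partial_z-\frac{x^2+y^2}{2}\partial_w$, $X_2=\partial_y+\frac x2\partial_z+\frac{x^2+y^2}{2}\partial_v$, $X_3=\partial_z+x\partial_v+y\partial_w$, $X_4=\partial_v$, $X_5=\partial_w$ (left-invariant fields on the Cartan group $M$, with identity $\mathrm{Id}=0$; nonzero brackets $[X_1,X_2]=X_3$, $[X_1,X_3]=X_4$, $[X_2,X_3]=X_5$). Time-optimal problem: $\dot q=u_1X_1(q)+u_2X_2(q)$, $u=(u_1,u_2)$ measurable with values in $U=\{u\in\mathbb R^2:\max(|u_1|,|u_2|)\le 1\}$, $q(0)=\mathrm{Id}$, $q(T)=q_1$, $T\to\min$. A trajectory $q(t)$, $t\in[0,T]$, from $\mathrm{Id}$ is optimal if no admissible control steers $\mathrm{Id}$ to $q(T)$ in time less than $T$. For $\lambda\in T^*M$ set $h_i(\lambda)=\langle\lambda,X_i\rangle$, $i=1,\dots,5$, and $H=|h_1|+|h_2|$. A normal extremal is a Lipschitz curve $\lambda_t\in T^*_{q(t)}M$, $t\in[0,T]$, with an admissible control $u$, satisfying $\dot h_1=-u_2h_3$, $\dot h_2=u_1h_3$, $\dot h_3=u_1h_4+u_2h_5$, $\dot h_4=\dot h_5=0$, $\dot q=u_1X_1+u_2X_2$, the maximum condition $u_1(t)h_1(\lambda_t)+u_2(t)h_2(\lambda_t)=\max_{v\in U}(v_1h_1+v_2h_2)(\lambda_t)=H(\lambda_t)$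 for a.e. $t$, and $H(\lambda_t)\equiv\mathrm{const}>0$. A singular trajectory is the projection $q(t)$, $t\in[0,T]$, with $q(0)=\mathrm{Id}$, of a normal extremal for which $h_1(\lambda_t)\equiv0$ on $(0,T)$ or $h_2(\lambda_t)\equiv0$ on $(0,T)$. *)

theory Defs
  imports "HOL-Analysis.Analysis"
begin

text \<open>Points \<open>(x, y, z, v, w)\<close> of the Cartan group; the group identity is \<open>0\<close>.
  Tangent spaces are identified with the same vector space.\<close>

type_synonym cartan = "real \<times> real \<times> real \<times> real \<times> real"

definition X1 :: "cartan \<Rightarrow> cartan" where
  "X1 = (\<lambda>(x, y, z, v, w). (1, 0, - y / 2, 0, - (x\<^sup>2 + y\<^sup>2) / 2))"

definition X2 :: "cartan \<Rightarrow> cartan" where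
  "X2 = (\<lambda>(x, y, z, v, w). (0, 1, x / 2, (x\<^sup>2 + y\<^sup>2) / 2, 0))"

definition X3 :: "cartan \<Rightarrow> cartan" where
  "X3 = (\<lambda>(x, y, z, v, w). (0, 0, 1, x, y))"

definition X4 :: "cartan \<Rightarrow> cartan" where
  "X4 = (\<lambda>(x, y, z, v, w). (0, 0, 0, 1, 0))"

definition X5 :: "cartan \<Rightarrow> cartan" where
  "X5 = (\<lambda>(x, y, z, v, w). (0, 0, 0, 0, 1))"

definition control_set :: "(real \<times> real) set" where
  "control_set = {u. max \<bar>fst u\<bar> \<bar>snd u\<bar> \<le> 1}"

definition admissible_control :: "real \<Rightarrow> (real \<Rightarrow> real \<times> real) \<Rightarrow> bool" where
  "admissible_control T u \<longleftrightarrow>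
     u \<in> borel_measurable (lebesgue_on {0..T}) \<and> (\<forall>t\<in>{0..T}. u t \<in> control_set)"

text \<open>Controls are bounded, so an absolutely continuous solution on the compact interval
  \<open>[0, T]\<close> is the same as a Lipschitz curve satisfying the equation almost everywhere.\<close>

definition trajectory :: "real \<Rightarrow> (real \<Rightarrow> real \<times> real) \<Rightarrow> (real \<Rightarrow> cartan) \<Rightarrow> bool" where
  "trajectory T u q \<longleftrightarrow>
     0 \<le> T \<and> admissible_control T u \<and> (\<exists>L. L-lipschitz_on {0..T} q) \<and>
     (AE t in lebesgue_on {0..T}.
        (q has_vector_derivative fst (u t) *\<^sub>R X1 (q t) + snd (u t) *\<^sub>R X2 (q t))
          (at t within {0..T}))"

definition steers :: "real \<Rightarrow> (real \<Rightarrow> real \<times> real) \<Rightarrow> cartan \<Rightarrow> cartan \<Rightarrow> bool" where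
  "steers T u a b \<longleftrightarrow> (\<exists>q. trajectory T u q \<and> q 0 = a \<and> q T = b)"

definition optimal :: "real \<Rightarrow> (real \<Rightarrow> cartan) \<Rightarrow> bool" where
  "optimal T q \<longleftrightarrow>
     (\<exists>u. trajectory T u q) \<and> q 0 = 0 \<and> \<not> (\<exists>T' u. T' < T \<and> steers T' u 0 (q T))"

text \<open>The cotangent bundle, trivialised by the global coordinates: a base point together with a
  linear functional on the tangent space there.\<close>

type_synonym cotangent = "cartan \<times> (cartan \<Rightarrow>\<^sub>L real)"

definition ham :: "(cartan \<Rightarrow> cartan) \<Rightarrow> cotangent \<Rightarrow> real" where
  "ham X l = blinfun_apply (snd l) (X (fst l))"

abbreviation "h1 \<equiv> ham X1"
abbreviation "h2 \<equiv> ham X2"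
abbreviation "h3 \<equiv> ham X3"
abbreviation "h4 \<equiv> ham X4"
abbreviation "h5 \<equiv> ham X5"

definition H :: "cotangent \<Rightarrow> real" where
  "H l = \<bar>h1 l\<bar> + \<bar>h2 l\<bar>"

definition normal_extremal :: "real \<Rightarrow> (real \<Rightarrow> real \<times> real) \<Rightarrow> (real \<Rightarrow> cotangent) \<Rightarrow> bool" where
  "normal_extremal T u lam \<longleftrightarrow>
     0 \<le> T \<and> admissible_control T u \<and> (\<exists>L. L-lipschitz_on {0..T} lam) \<and>
     (AE t in lebesgue_on {0..T}.
        ((\<lambda>s. h1 (lam s)) has_real_derivative - snd (u t) * h3 (lam t)) (at t within {0..T}) \<and>
        ((\<lambda>s. h2 (lam s)) has_real_derivative fst (u t) * h3 (lam t)) (at t within {0..T}) \<and>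
        ((\<lambda>s. h3 (lam s)) has_real_derivative
           fst (u t) * h4 (lam t) + snd (u t) * h5 (lam t)) (at t within {0..T}) \<and>
        ((\<lambda>s. h4 (lam s)) has_real_derivative 0) (at t within {0..T}) \<and>
        ((\<lambda>s. h5 (lam s)) has_real_derivative 0) (at t within {0..T}) \<and>
        ((\<lambda>s. fst (lam s)) has_vector_derivative
           fst (u t) *\<^sub>R X1 (fst (lam t)) + snd (u t) *\<^sub>R X2 (fst (lam t))) (at t within {0..T})) \<and>
     (AE t in lebesgue_on {0..T}.
        fst (u t) * h1 (lam t) + snd (u t) * h2 (lam t) =
          (SUP v\<in>control_set. fst v * h1 (lam t) + snd v * h2 (lam t))) \<and>
     (\<exists>c>0. \<forall>t\<in>{0..T}. H (lam t) = c)"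

text \<open>The supremum in the maximum condition is attained, and equals \<open>H\<close>.\<close>

lemma max_eq_H:
  "(SUP v\<in>control_set. fst v * h1 l + snd v * h2 l) = H l"
  "\<exists>v\<in>control_set. fst v * h1 l + snd v * h2 l = H l"
proof -
  let ?f = "\<lambda>v. fst v * h1 l + snd v * h2 l"
  let ?v = "(if h1 l \<ge> 0 then 1 else - 1, if h2 l \<ge> 0 then 1 else - 1) :: real \<times> real"
  have v: "?v \<in> control_set" "?f ?v = H l"
    by (auto simp: control_set_def H_def)
  then show "\<exists>v\<in>control_set. ?f v = H l" by blast
  have le: "?f u \<le> H l" if "u \<in> control_set" for u
  proof -
    have "fst u * h1 l \<le> \<bar>h1 l\<bar>" "snd u * h2 l \<le> \<bar>h2 l\<bar>"
      using that mult_right_mono[of "\<bar>fst u\<bar>" 1 "\<bar>h1 l\<bar>"] mult_right_mono[of "\<bar>snd u\<bar>" 1 "\<bar>h2 l\<bar>"]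
      by (auto simp: control_set_def abs_mult[symmetric])
    then show ?thesis by (simp add: H_def)
  qed
  show "(SUP v\<in>control_set. ?f v) = H l"
    using v le by (intro cSup_eq_maximum) (auto intro!: image_eqI[of _ _ ?v])
qed

definition singular_trajectory :: "real \<Rightarrow> (real \<Rightarrow> cartan) \<Rightarrow> bool" where
  "singular_trajectory T q \<longleftrightarrow>
     q 0 = 0 \<and>
     (\<exists>u lam. normal_extremal T u lam \<and> (\<forall>t\<in>{0..T}. q t = fst (lam t)) \<and>
        ((\<forall>t\<in>{0<..<T}. h1 (lam t) = 0) \<or> (\<forall>t\<in>{0<..<T}. h2 (lam t) = 0)))"

end

theory Submission
  imports Defs
begin

text \<open>Along a singular extremal one of \<open>h1\<close>, \<open>h2\<close> vanishes, so the other one is continuous and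
  never zero. The maximum condition then forces the corresponding control to be constantly
  \<open>1\<close> or constantly \<open>- 1\<close>, whence \<open>\<bar>x\<bar> = T\<close> or \<open>\<bar>y\<bar> = T\<close> at the
  end point. Since \<open>\<bar>u1\<bar>, \<bar>u2\<bar> \<le> 1\<close>, no admissible curve reaches such a point in
  time less than \<open>T\<close>.\<close>

section \<open>Growth of Lipschitz functions from derivative bounds almost everywhere\<close>

text \<open>The image of the exceptional null set is null, so some level between \<open>f a\<close> and \<open>f b\<close>
  avoids it; the derivative at the last crossing of this level cannot be negative.\<close>

lemma lipschitz_AE_neg_deriv_le:
  fixes f :: "real \<Rightarrow> real"
  assumes "a \<le> b" and lip: "L-lipschitz_on {a..b} f"
    and der: "AE t in lebesgue_on {a..b}. \<exists>D<0. (f has_real_derivative D) (at t within {a..b})"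
  shows "f b \<le> f a"
proof (rule ccontr)
  assume "\<not> f b \<le> f a"
  then have less: "f a < f b" by simp
  have cont: "continuous_on {a..b} f"
    using lip by (rule lipschitz_on_continuous_on)
  define N where "N = {t \<in> {a..b}. \<not> (\<exists>D<0. (f has_real_derivative D) (at t within {a..b}))}"
  have "AE t in lebesgue. t \<notin> N"
    using der by (auto simp: AE_restrict_space_iff N_def elim: AE_mp)
  \<comment> \<open>\<open>N\<close> is known only to lie inside a null set; completeness of
    Lebesgue measure makes it null itself.\<close>
  then have "negligible N"
    by (auto simp: negligible_iff_null_sets eventually_ae_filter
        intro: completion.complete2)
  then have "negligible (f ` N)"
  proof (rule negligible_locally_Lipschitz_image[rotated])
    show "\<exists>U B. open U \<and> x \<in> U \<and> (\<forall>y\<in>N \<inter> U. norm (f y - f x) \<le> B * norm (y - x))"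
      if "x \<in> N" for x
      using that lipschitz_onD[OF lip]
      by (intro exI[of _ UNIV] exI[of _ L]) (auto simp: N_def dist_norm)
  qed simp
  moreover have "\<not> negligible {f a<..<f b}"
    using less by (simp add: open_not_negligible)
  ultimately obtain c where c: "f a < c" "c < f b" "c \<notin> f ` N"
    by (meson greaterThanLessThan_iff negligible_subset subsetI)
  define S where "S = {t \<in> {a..b}. f t = c}"
  have "compact S"
    using continuous_closed_preimage[OF cont closed_atLeastAtMost closed_singleton[of c]]
    by (auto simp: S_def compact_eq_bounded_closed vimage_def Int_def
        intro: bounded_subset[of "{a..b}"])
  moreover have "S \<noteq> {}"
    using IVT'[of f a c b] c cont \<open>a \<le> b\<close> by (auto simp: S_def)
  ultimately obtain s where s: "s \<in> S" and last: "\<And>t. t \<in> S \<Longrightarrow> t \<le> s"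
    by (meson compact_attains_sup)
  then have s': "s \<in> {a..b}" "f s = c" by (auto simp: S_def)
  then have "s \<notin> N" using c by blast
  then obtain D where D: "D < 0" "(f has_real_derivative D) (at s within {a..b})"
    using s' by (auto simp: N_def)
  have "s < b" using s' c by (cases "s = b") auto
  obtain d where d: "d > 0" "\<And>h. 0 < h \<Longrightarrow> s + h \<in> {a..b} \<Longrightarrow> h < d \<Longrightarrow> f (s + h) < f s"
    using has_real_derivative_neg_dec_right[OF D(2,1)] by auto
  \<comment> \<open>Halving \<open>d\<close> gives the strict bound \<open>h < d\<close>, and
    \<open>b - s\<close> keeps \<open>s + h\<close> in the interval. As \<open>f\<close> is below
    \<open>c\<close> at \<open>s + h\<close> and above it at \<open>b\<close>, it meets
    \<open>c\<close> again after \<open>s\<close>.\<close>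
  define h where "h = min (d / 2) (b - s)"
  have h: "0 < h" "h < d" "s + h \<in> {a..b}"
    using d(1) \<open>s < b\<close> s' by (auto simp: h_def min_def)
  then have "f (s + h) < c" using d s' by auto
  moreover have "continuous_on {s + h..b} f"
    using h s' by (auto intro: continuous_on_subset[OF cont])
  ultimately obtain t where "s + h \<le> t" "t \<le> b" "f t = c"
    using IVT'[of f "s + h" c b] c h by auto
  then show False using last[of t] h s' by (auto simp: S_def)
qed

text \<open>Subtracting a line of slope \<open>M + e\<close> makes the derivative at most
  \<open>- e\<close> almost everywhere, so the strict case applies; then \<open>e\<close> tends to
  0. This stands in for integrating the derivative.\<close>

lemma lipschitz_AE_deriv_le:
  fixes f :: "real \<Rightarrow> real"
  assumes "a \<le> b" and lip: "L-lipschitz_on {a..b} f"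
    and der: "AE t in lebesgue_on {a..b}. \<exists>D\<le>M. (f has_real_derivative D) (at t within {a..b})"
  shows "f b - f a \<le> M * (b - a)"
proof -
  have *: "f b - f a \<le> (M + e) * (b - a)" if "e > 0" for e
  proof -
    have "1-lipschitz_on {a..b} (\<lambda>t::real. t)"
      by (auto intro: lipschitz_onI)
    from lipschitz_on_diff[OF lip lipschitz_on_cmult_real[OF this, of "M + e"]]
    have "(L + \<bar>M + e\<bar> * 1)-lipschitz_on {a..b} (\<lambda>t. f t - (M + e) * t)"
      by simp
    moreover have "AE t in lebesgue_on {a..b}. \<exists>D<0.
        ((\<lambda>t. f t - (M + e) * t) has_real_derivative D) (at t within {a..b})"
      using der
    proof (rule AE_mp, intro AE_I2 impI)
      fix t assume "\<exists>D\<le>M. (f has_real_derivative D) (at t within {a..b})"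
      then obtain D where "D \<le> M" "(f has_real_derivative D) (at t within {a..b})" by blast
      then show "\<exists>D<0. ((\<lambda>t. f t - (M + e) * t) has_real_derivative D) (at t within {a..b})"
        using \<open>e > 0\<close> by (intro exI[of _ "D - (M + e)"]) (auto intro!: derivative_eq_intros)
    qed
    ultimately have "f b - (M + e) * b \<le> f a - (M + e) * a"
      by (rule lipschitz_AE_neg_deriv_le[OF \<open>a \<le> b\<close>])
    then show ?thesis by (simp add: algebra_simps)
  qed
  show ?thesis
  \<comment> \<open>Dividing by \<open>b - a\<close> isolates \<open>e\<close> as an additive error,
    which can then be dropped; on a degenerate interval both sides are 0.\<close>
  proof (cases "a = b")
    case False
    with \<open>a \<le> b\<close> have "a < b" by simp
    have "(f b - f a) / (b - a) \<le> M + e" if "e > 0" for e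
      using *[OF that] \<open>a < b\<close> by (simp add: field_simps)
    then have "(f b - f a) / (b - a) \<le> M" by (rule field_le_epsilon)
    then show ?thesis using \<open>a < b\<close> by (simp add: field_simps)
  qed simp
qed

lemma lipschitz_AE_deriv_ge:
  fixes f :: "real \<Rightarrow> real"
  assumes "a \<le> b" and lip: "L-lipschitz_on {a..b} f"
    and der: "AE t in lebesgue_on {a..b}. \<exists>D\<ge>M. (f has_real_derivative D) (at t within {a..b})"
  shows "f b - f a \<ge> M * (b - a)"
proof -
  have "AE t in lebesgue_on {a..b}. \<exists>D\<le>- M.
      ((\<lambda>t. - f t) has_real_derivative D) (at t within {a..b})"
    using der
  proof (rule AE_mp, intro AE_I2 impI)
    fix t assume "\<exists>D\<ge>M. (f has_real_derivative D) (at t within {a..b})"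
    then show "\<exists>D\<le>- M. ((\<lambda>t. - f t) has_real_derivative D) (at t within {a..b})"
      by (metis DERIV_minus neg_le_iff_le)
  qed
  moreover have "L-lipschitz_on {a..b} (\<lambda>t. - f t)"
    using lip by simp
  ultimately have "- f b - - f a \<le> - M * (b - a)"
    using lipschitz_AE_deriv_le[OF \<open>a \<le> b\<close>] by blast
  then show ?thesis by simp
qed

section \<open>The coordinates x and y along trajectories\<close>

lemma lipschitz_on_fst_snd:
  assumes "L-lipschitz_on S f"
  shows "L-lipschitz_on S (\<lambda>t. fst (f t))" "L-lipschitz_on S (\<lambda>t. snd (f t))"
  using assms
  by (auto simp: lipschitz_on_def intro: order_trans[OF dist_fst_le] order_trans[OF dist_snd_le])

text \<open>The (x, y)-parts of \<open>X1\<close> and \<open>X2\<close> are the constants (1, 0) and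
  (0, 1), so each of these coordinates is driven by a single control.\<close>

lemma trajectory_xy:
  assumes "trajectory T u q"
  shows "\<exists>L. L-lipschitz_on {0..T} (\<lambda>t. fst (q t))"
    and "\<exists>L. L-lipschitz_on {0..T} (\<lambda>t. fst (snd (q t)))"
    and "AE t in lebesgue_on {0..T}.
      ((\<lambda>t. fst (q t)) has_real_derivative fst (u t)) (at t within {0..T})"
    and "AE t in lebesgue_on {0..T}.
      ((\<lambda>t. fst (snd (q t))) has_real_derivative snd (u t)) (at t within {0..T})"
proof -
  from assms show "\<exists>L. L-lipschitz_on {0..T} (\<lambda>t. fst (q t))"
    and "\<exists>L. L-lipschitz_on {0..T} (\<lambda>t. fst (snd (q t)))"
    unfolding trajectory_def using lipschitz_on_fst_snd by blast+
  have *: "((\<lambda>t. fst (q t)) has_real_derivative fst (u t)) (at t within {0..T}) \<and>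
      ((\<lambda>t. fst (snd (q t))) has_real_derivative snd (u t)) (at t within {0..T})"
    if "(q has_vector_derivative fst (u t) *\<^sub>R X1 (q t) + snd (u t) *\<^sub>R X2 (q t))
          (at t within {0..T})" for t
    using bounded_linear.has_vector_derivative[OF bounded_linear_fst that]
      bounded_linear.has_vector_derivative[OF bounded_linear_fst_comp[OF bounded_linear_snd] that]
    by (simp add: has_real_derivative_iff_has_vector_derivative X1_def X2_def split_beta)
  have ae: "AE t in lebesgue_on {0..T}.
      (q has_vector_derivative fst (u t) *\<^sub>R X1 (q t) + snd (u t) *\<^sub>R X2 (q t))
          (at t within {0..T})"
    using assms by (simp add: trajectory_def)
  show "AE t in lebesgue_on {0..T}.
      ((\<lambda>t. fst (q t)) has_real_derivative fst (u t)) (at t within {0..T})"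
    and "AE t in lebesgue_on {0..T}.
      ((\<lambda>t. fst (snd (q t))) has_real_derivative snd (u t)) (at t within {0..T})"
    using * by (auto intro: AE_mp[OF ae])
qed

text \<open>The end points form a null set. Singularity is prescribed only on the open interval, and
  pointwise arguments below also need \<open>t\<close> to lie in the interval.\<close>

lemma AE_lebesgue_on_greaterThanLessThan:
  fixes a b :: real
  shows "AE t in lebesgue_on {a..b}. t \<in> {a<..<b}"
proof -
  have "{a, b} \<in> null_sets lebesgue"
    by (simp add: negligible_iff_null_sets[symmetric])
  then have "AE t in lebesgue. t \<notin> {a, b}" by (rule AE_not_in)
  then show ?thesis by (auto simp: AE_restrict_space_iff elim: AE_mp)
qed

lemma lipschitz_AE_deriv_abs_le:
  fixes f :: "real \<Rightarrow> real"
  assumes "0 \<le> T" and lip: "\<exists>L. L-lipschitz_on {0..T} f"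
    and der: "AE t in lebesgue_on {0..T}. (f has_real_derivative g t) (at t within {0..T})"
    and g: "\<And>t. t \<in> {0..T} \<Longrightarrow> \<bar>g t\<bar> \<le> 1"
  shows "\<bar>f T - f 0\<bar> \<le> T"
proof -
  obtain L where L: "L-lipschitz_on {0..T} f" using lip by blast
  have "AE t in lebesgue_on {0..T}. \<exists>D\<le>1. (f has_real_derivative D) (at t within {0..T})"
    using der AE_lebesgue_on_greaterThanLessThan[of 0 T]
  proof eventually_elim
    case (elim t)
    then show ?case using g[of t] by (intro exI[of _ "g t"]) auto
  qed
  moreover have "AE t in lebesgue_on {0..T}. \<exists>D\<ge>-1. (f has_real_derivative D) (at t within {0..T})"
    using der AE_lebesgue_on_greaterThanLessThan[of 0 T]
  proof eventually_elim
    case (elim t)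
    then show ?case using g[of t] by (intro exI[of _ "g t"]) auto
  qed
  ultimately show ?thesis
    using lipschitz_AE_deriv_le[OF \<open>0 \<le> T\<close> L, of 1] lipschitz_AE_deriv_ge[OF \<open>0 \<le> T\<close> L, of "-1"]
    by auto
qed

text \<open>This is the lower bound on travel time for any competitor: x and y change with speed at
  most 1.\<close>

lemma trajectory_xy_le:
  assumes "trajectory T u q" "q 0 = 0"
  shows "\<bar>fst (q T)\<bar> \<le> T" "\<bar>fst (snd (q T))\<bar> \<le> T"
proof -
  have u: "\<bar>fst (u t)\<bar> \<le> 1" "\<bar>snd (u t)\<bar> \<le> 1" if "t \<in> {0..T}" for t
    using assms that by (auto simp: trajectory_def admissible_control_def control_set_def)
  have T: "0 \<le> T" using assms by (simp add: trajectory_def)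
  show "\<bar>fst (q T)\<bar> \<le> T"
    using lipschitz_AE_deriv_abs_le[OF T trajectory_xy(1,3)[OF assms(1)] u(1)] assms(2) by simp
  show "\<bar>fst (snd (q T))\<bar> \<le> T"
    using lipschitz_AE_deriv_abs_le[OF T trajectory_xy(2,4)[OF assms(1)] u(2)] assms(2) by simp
qed

section \<open>Controls with a nonvanishing switching function\<close>

lemma connected_nonzero_sign:
  fixes k :: "'a::topological_space \<Rightarrow> real"
  assumes "connected S" "continuous_on S k" "\<And>t. t \<in> S \<Longrightarrow> k t \<noteq> 0"
  shows "(\<forall>t\<in>S. k t > 0) \<or> (\<forall>t\<in>S. k t < 0)"
proof (rule ccontr)
  assume "\<not> ?thesis"
  then obtain s t where "s \<in> S" "t \<in> S" "k s < 0" "0 < k t"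
    using assms(3) by (meson linorder_neqE_linordered_idom)
  moreover have "connected (k ` S)"
    using assms by (blast intro: connected_continuous_image)
  ultimately have "0 \<in> k ` S"
    by (meson connectedD_interval imageI less_imp_le)
  then show False using assms(3) by auto
qed

text \<open>Here \<open>k\<close> is a switching function, \<open>g\<close> its control component
  and \<open>f\<close> the coordinate driven by \<open>g\<close>. As \<open>k\<close> keeps its
  sign, \<open>g\<close> equals that sign almost everywhere, and \<open>f\<close> moves one way at
  unit speed.\<close>

lemma bang_control_endpoint:
  fixes f k :: "real \<Rightarrow> real"
  assumes "0 \<le> T" and lip: "\<exists>L. L-lipschitz_on {0..T} f"
    and der: "AE t in lebesgue_on {0..T}. (f has_real_derivative g t) (at t within {0..T})"
    and k: "continuous_on {0<..<T} k" "\<And>t. t \<in> {0<..<T} \<Longrightarrow> k t \<noteq> 0"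
    and mx: "AE t in lebesgue_on {0..T}. t \<in> {0<..<T} \<longrightarrow> g t * k t = \<bar>k t\<bar>"
  shows "T \<le> \<bar>f T - f 0\<bar>"
proof -
  obtain L where L: "L-lipschitz_on {0..T} f" using lip by blast
  note ae = der mx AE_lebesgue_on_greaterThanLessThan[of 0 T]
  \<comment> \<open>For \<open>T = 0\<close> the open interval is empty and both cases hold
    vacuously.\<close>
  consider "\<forall>t\<in>{0<..<T}. k t > 0" | "\<forall>t\<in>{0<..<T}. k t < 0"
    using connected_nonzero_sign[OF _ k] by auto
  then show ?thesis
  proof cases
    case 1
    have "AE t in lebesgue_on {0..T}. \<exists>D\<ge>1. (f has_real_derivative D) (at t within {0..T})"
      using ae
    proof eventually_elim
      case (elim t)
      then have "k t > 0" "g t * k t = \<bar>k t\<bar>" using 1 by blast+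
      then show ?case using elim by force
    qed
    from lipschitz_AE_deriv_ge[OF \<open>0 \<le> T\<close> L this] show ?thesis by simp
  next
    case 2
    have "AE t in lebesgue_on {0..T}. \<exists>D\<le>-1. (f has_real_derivative D) (at t within {0..T})"
      using ae
    proof eventually_elim
      case (elim t)
      then have "k t < 0" "g t * k t = \<bar>k t\<bar>" using 2 by blast+
      then have "g t * k t = (- 1) * k t" "k t \<noteq> 0" by auto
      then have "g t = - 1" by (metis mult_right_cancel)
      then show ?case using elim by force
    qed
    from lipschitz_AE_deriv_le[OF \<open>0 \<le> T\<close> L this] show ?thesis by simp
  qed
qed

lemma continuous_on_ham:
  assumes "continuous_on S lam"
  shows "continuous_on S (\<lambda>t. h1 (lam t))" "continuous_on S (\<lambda>t. h2 (lam t))"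
  unfolding ham_def X1_def X2_def split_beta
  using assms by (auto intro!: continuous_intros)

theorem corollary2:
  fixes T :: real and q :: "real \<Rightarrow> cartan"
  assumes "singular_trajectory T q"
  shows "optimal T q"
proof -
  obtain u lam where q0: "q 0 = 0" and ext: "normal_extremal T u lam"
    and q: "\<And>t. t \<in> {0..T} \<Longrightarrow> q t = fst (lam t)"
    and sing: "(\<forall>t\<in>{0<..<T}. h1 (lam t) = 0) \<or> (\<forall>t\<in>{0<..<T}. h2 (lam t) = 0)"
    using assms unfolding singular_trajectory_def by blast
  have T: "0 \<le> T" using ext by (simp add: normal_extremal_def)
  obtain L where L: "L-lipschitz_on {0..T} lam"
    using ext unfolding normal_extremal_def by blast
  obtain c where c: "c > 0" "\<And>t. t \<in> {0..T} \<Longrightarrow> H (lam t) = c"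
    using ext unfolding normal_extremal_def by blast
  have mx: "AE t in lebesgue_on {0..T}. fst (u t) * h1 (lam t) + snd (u t) * h2 (lam t) = H (lam t)"
    using ext by (simp add: normal_extremal_def max_eq_H)
  have "L-lipschitz_on {0..T} q"
    using lipschitz_on_fst_snd(1)[OF L] q by (simp add: lipschitz_on_def)
  moreover have "AE t in lebesgue_on {0..T}.
      ((\<lambda>s. fst (lam s)) has_vector_derivative
         fst (u t) *\<^sub>R X1 (fst (lam t)) + snd (u t) *\<^sub>R X2 (fst (lam t))) (at t within {0..T})"
    using ext unfolding normal_extremal_def by (auto elim: AE_mp)
  then have "AE t in lebesgue_on {0..T}.
      (q has_vector_derivative fst (u t) *\<^sub>R X1 (q t) + snd (u t) *\<^sub>R X2 (q t))
        (at t within {0..T})"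
    using AE_lebesgue_on_greaterThanLessThan[of 0 T]
  proof eventually_elim
    case (elim t)
    then have t: "t \<in> {0..T}" by auto
    \<comment> \<open>\<open>q\<close> and the projection of \<open>lam\<close> are known to agree
      only on \<open>{0..T}\<close>; this suffices because the derivative is taken within that
      interval.\<close>
    show ?case
      using has_vector_derivative_transform[OF t q elim(1)] q[OF t] by simp
  qed
  ultimately have traj: "trajectory T u q"
    using ext T by (auto simp: trajectory_def normal_extremal_def)
  have cont: "continuous_on {0<..<T} lam"
    using lipschitz_on_continuous_on[OF L] by (rule continuous_on_subset) auto
  have far: "T \<le> \<bar>fst (q T)\<bar> \<or> T \<le> \<bar>fst (snd (q T))\<bar>"
    using sing
  proof
    assume h: "\<forall>t\<in>{0<..<T}. h1 (lam t) = 0"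
    \<comment> \<open>With \<open>h1 = 0\<close>, the constant value \<open>c > 0\<close> of
      \<open>H\<close> is \<bar>h2\<bar>, and the maximum condition involves only the second
      control, which drives y.\<close>
    then have "h2 (lam t) \<noteq> 0" if "t \<in> {0<..<T}" for t
      using c(1) c(2)[of t] that by (auto simp: H_def)
    moreover have "AE t in lebesgue_on {0..T}.
        t \<in> {0<..<T} \<longrightarrow> snd (u t) * h2 (lam t) = \<bar>h2 (lam t)\<bar>"
      using mx by eventually_elim (use h in \<open>auto simp: H_def\<close>)
    ultimately show ?thesis
      using bang_control_endpoint[OF T trajectory_xy(2,4)[OF traj] continuous_on_ham(2)[OF cont]] q0
      by simp
  next
    assume h: "\<forall>t\<in>{0<..<T}. h2 (lam t) = 0"
    \<comment> \<open>By the same argument with the roles exchanged, the first control is bang and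
      drives x.\<close>
    then have "h1 (lam t) \<noteq> 0" if "t \<in> {0<..<T}" for t
      using c(1) c(2)[of t] that by (auto simp: H_def)
    moreover have "AE t in lebesgue_on {0..T}.
        t \<in> {0<..<T} \<longrightarrow> fst (u t) * h1 (lam t) = \<bar>h1 (lam t)\<bar>"
      using mx by eventually_elim (use h in \<open>auto simp: H_def\<close>)
    ultimately show ?thesis
      using bang_control_endpoint[OF T trajectory_xy(1,3)[OF traj] continuous_on_ham(1)[OF cont]] q0
      by simp
  qed
  \<comment> \<open>A competitor would end with \<bar>x\<bar> and \<bar>y\<bar> at most
    \<open>T'\<close>, while one of them is at least \<open>T\<close>.\<close>
  have "\<not> steers T' u' 0 (q T)" if "T' < T" for T' u'
    using trajectory_xy_le[of T' u'] far that by (fastforce simp: steers_def)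
  then show ?thesis
    using traj q0 by (auto simp: optimal_def)
qed

end
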